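(* Let $p$ be a prime. Then $\mathscr{A}(p)\supset\mathscr{B}(p)$. Moreover, for $(r,e,d)\in\mathscr{B}(p)$ the exponent is $g=2e-(p-1)$, i.e. $\det M_d(f(x)^e)=\varepsilon_{p,r,e,d}\,\delta(x_1,\ldots,x_r)^{2e-(p-1)}$, and the constant $\varepsilon_{p,r,e,d}\in\mathbb{F}_p^{\times}$ is given by \[ \varepsilon_{p,r,e,d}=\begin{cases}(-1)^{r-1}\,\varepsilon_{p,r,e,d-1} & \text{if } (r,e,d)\in\mathscr{B}_+(p),\\[2pt] (-1)^{\frac{(r+1)(r+2)}{2}+\frac{r(r+1)}{2}e}\,\{r(p-1-e)\}!\,(e!)^r & \text{if } (r,e,d)\in\mathscr{B}_0(p),\\[2pt] (-1)^{r}\,\varepsilon_{p,r,e,d+1} & \text{if } (r,e,d)\in\mathscr{B}_-(p).\end{cases} \] (Here, if $(r,e,d)\in\mathscr{B}_+(p)$ then $(r,e,d-1)\in\mathscr{B}_0(p)$, and if $(r,e,d)\in\mathscr{B}_-(p)$ then $(r,e,d+1)\in\mathscr{B}_0(p)$.)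
   Context: Let $p$ be a prime. For an integer $r\ge 2$ let $x_1,\ldots,x_r$ be independent indeterminates over $\mathbb{F}_p$ and $f(x)=(x-x_1)\cdots(x-x_r)=x^r+s_1x^{r-1}+\cdots+s_r\in\mathbb{F}_p[x_1,\ldots,x_r][x]$. For integers $e\ge 0$ and $0\le d\le p$ write $f(x)^e=\sum_{i\ge0}c_ix^i$ (with $c_i=0$ for $i<0$) and let $M_d(f(x)^e)$ be the $d\times d$ matrix whose $(i,j)$ entry is $c_{ip+j-d-1}$ ($1\le i,j\le d$). Put $\delta(x_1,\ldots,x_r)=\prod_{1\le i<j\le r}(x_i-x_j)$. Define $\mathscr{A}(p)$ as the set of $(r,e,d)\in\mathbb{Z}^3$ with $r\ge2$, $e\ge1$, $1\le d\le p$, such that there exist $\varepsilon_{p,r,e,d}\in\mathbb{F}_p^{\times}$ and a positive integer $g$ with $\det M_d(f(x)^e)=\varepsilon_{p,r,e,d}\,\delta(x_1,\ldots,x_r)^g$. Define $\mathscr{B}_+(p)=\{(r,e,d): 2\le r\le p,\ e=p-1,\ d=r\}$, $\mathscr{B}_0(p)=\{(r,e,d): 2\le r\le p+1,\ (p-1)/2<e\le p-1,\ r(p-1-e)\le p-1,\ d=r-1\}$, $\mathscr{B}_-(p)=\{(r,e,d): r\ge2,\ (p-1)/2<e\le p-1,\ r(p-1-e)=p-1,\ d=r-2\}$ (all integer triples), and $\mathscr{B}(p)=\mathscr{B}_+(p)\cup\mathscr{B}_0(p)\cup\mathscr{B}_-(p)$. *)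

theory Defs
  imports "HOL-Computational_Algebra.Polynomial" "Jordan_Normal_Form.Determinant"
begin

definition fpoly :: "nat \<Rightarrow> (nat \<Rightarrow> 'a::comm_ring_1) \<Rightarrow> 'a poly" where
  "fpoly r x = (\<Prod>i\<in>{1..r}. [:- x i, 1:])"

text \<open>M_d(q): d x d matrix with (i,j) entry c_{ip+j-d-1} (1-based i,j; c_k = 0 for k<0).
  Jordan_Normal_Form matrices are 0-based, so entry (i,j) uses (i+1)p+(j+1)-d-1.\<close>
definition Mmat :: "nat \<Rightarrow> nat \<Rightarrow> 'a::comm_ring_1 poly \<Rightarrow> 'a mat" where
  "Mmat p d q = mat d d (\<lambda>(i,j).
     (let k = int ((i+1)*p + (j+1)) - int d - 1 in if k < 0 then 0 else coeff q (nat k)))"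

definition delta :: "nat \<Rightarrow> (nat \<Rightarrow> 'a::comm_ring_1) \<Rightarrow> 'a" where
  "delta r x = (\<Prod>i\<in>{1..r}. \<Prod>j\<in>{i+1..r}. (x i - x j))"

definition A_set :: "'a::comm_ring_1 itself \<Rightarrow> nat \<Rightarrow> (nat \<times> nat \<times> nat) set" where
  "A_set _ p = {(r,e,d). 2 \<le> r \<and> 1 \<le> e \<and> 1 \<le> d \<and> d \<le> p \<and>
     (\<exists>\<epsilon>::int. \<not> int p dvd \<epsilon> \<and> (\<exists>g::nat. 0 < g \<and>
        (\<forall>x :: nat \<Rightarrow> 'a. det (Mmat p d (fpoly r x ^ e)) = of_int \<epsilon> * delta r x ^ g)))}"

definition B_plus :: "nat \<Rightarrow> (nat \<times> nat \<times> nat) set" where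
  "B_plus p = {(r,e,d). 2 \<le> r \<and> r \<le> p \<and> e = p - 1 \<and> d = r}"

definition B_zero :: "nat \<Rightarrow> (nat \<times> nat \<times> nat) set" where
  "B_zero p = {(r,e,d). 2 \<le> r \<and> r \<le> p + 1 \<and> p - 1 < 2 * e \<and> e \<le> p - 1 \<and>
      r * (p - 1 - e) \<le> p - 1 \<and> d = r - 1}"

definition B_minus :: "nat \<Rightarrow> (nat \<times> nat \<times> nat) set" where
  "B_minus p = {(r,e,d). 2 \<le> r \<and> p - 1 < 2 * e \<and> e \<le> p - 1 \<and>
      r * (p - 1 - e) = p - 1 \<and> d = r - 2}"

definition B_set :: "nat \<Rightarrow> (nat \<times> nat \<times> nat) set" where
  "B_set p = B_plus p \<union> B_zero p \<union> B_minus p"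

definition eps0 :: "nat \<Rightarrow> nat \<Rightarrow> nat \<Rightarrow> int" where
  "eps0 p r e = (-1) ^ ((r+1)*(r+2) div 2 + (r*(r+1) div 2) * e)
                 * int (fact (r * (p - 1 - e))) * int (fact e) ^ r"

definition epsB :: "nat \<Rightarrow> nat \<Rightarrow> nat \<Rightarrow> nat \<Rightarrow> int" where
  "epsB p r e d =
     (if (r,e,d) \<in> B_plus p then (-1) ^ (r - 1) * eps0 p r e
      else if (r,e,d) \<in> B_zero p then eps0 p r e
      else (-1) ^ r * eps0 p r e)"

end

theory Submission
  imports Defs "HOL-Number_Theory.Residues" "Jordan_Normal_Form.Char_Poly"
begin

hide_const (open) up_ring.coeff up_ring.monom

text \<open>The matrix of \<open>f ^ e\<close> is that of \<open>g \<mapsto> C (g f ^ e)\<close> on polynomials of degree below \<open>d\<close>, where the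
  Cartier-type operator \<open>C\<close> extracts the coefficients at the exponents \<open>i p - 1\<close>. In characteristic
  \<open>p\<close> it satisfies \<open>C (u ^ p v) = u\<^sup>(\<^sup>p\<^sup>) C v\<close>, with \<open>u\<^sup>(\<^sup>p\<^sup>)\<close> the Frobenius twist, and kills derivatives. The first
  property gives the case \<open>e = p - 1\<close>, \<open>d = r\<close>. The second, applied to \<open>(h f ^ e)'\<close> and combined
  with division of \<open>e h f'\<close> by \<open>f\<close>, relates the determinants for \<open>e\<close> and \<open>e - 1\<close> by the factor
  \<open>e ^ r \<Prod> f' (x i) = \<plusminus> e ^ r \<delta>\<^sup>2\<close> on one side and a product of leading coefficients on the other. When
  \<open>d (p - 1) = r e\<close>, the last row is a unit vector because \<open>f\<close> is monic, which relates \<open>d\<close> and \<open>d - 1\<close>.\<close>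

section \<open>Formal derivatives over commutative rings\<close>

text \<open>\<^const>\<open>pderiv\<close> is only available over rings without zero divisors.\<close>

definition formal_deriv :: "'a::comm_ring_1 poly \<Rightarrow> 'a poly" where
  "formal_deriv q = (\<Sum>i\<le>degree q. monom (of_nat i * coeff q i) (i - 1))"

lemma coeff_formal_deriv:
  "coeff (formal_deriv q) n = of_nat (Suc n) * coeff q (Suc n)"
proof -
  have *: "coeff (monom (of_nat i * coeff q i) (i - 1)) n
      = (if i = Suc n then of_nat (Suc n) * coeff q (Suc n) else 0)" for i
    by (cases i) auto
  show ?thesis
    unfolding formal_deriv_def coeff_sum *
    by (auto simp: sum.delta' not_le coeff_eq_0)
qed

lemma formal_deriv_0 [simp]: "formal_deriv 0 = 0"
  by (rule poly_eqI) (simp add: coeff_formal_deriv)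

lemma formal_deriv_add: "formal_deriv (p + q) = formal_deriv p + formal_deriv q"
  by (rule poly_eqI) (simp add: coeff_formal_deriv algebra_simps)

lemma formal_deriv_smult: "formal_deriv (smult c q) = smult c (formal_deriv q)"
  by (rule poly_eqI) (simp add: coeff_formal_deriv algebra_simps)

lemma formal_deriv_pCons: "formal_deriv (pCons c q) = q + pCons 0 (formal_deriv q)"
  by (rule poly_eqI) (auto simp: coeff_formal_deriv coeff_pCons algebra_simps split: nat.splits)

lemma formal_deriv_mult:
  "formal_deriv (p * q) = formal_deriv p * q + p * formal_deriv q"
proof (induction p)
  case (pCons c p)
  show ?case
    by (simp add: formal_deriv_pCons formal_deriv_add formal_deriv_smult pCons.IH algebra_simps)
qed auto

lemma formal_deriv_power_Suc:
  "formal_deriv (q ^ Suc n) = of_nat (Suc n) * q ^ n * formal_deriv q"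
proof (induction n)
  case (Suc n)
  have "formal_deriv (q ^ Suc (Suc n)) = formal_deriv q * q ^ Suc n + q * formal_deriv (q ^ Suc n)"
    by (simp only: power_Suc formal_deriv_mult)
  then show ?case unfolding Suc.IH by (simp add: algebra_simps)
qed simp

text \<open>The coefficient at exponent \<open>n\<close> carries the factor \<open>n + 1\<close>,
  here a multiple of \<open>p\<close>. This is the property that \<open>C\<close> kills
  derivatives.\<close>

lemma coeff_formal_deriv_CHAR:
  fixes q :: "'a::comm_ring_1 poly"
  assumes "CHAR('a) = p" and "p > 0"
  shows "coeff (formal_deriv q) ((i + 1) * p - 1) = 0"
proof -
  have "Suc ((i + 1) * p - 1) = (i + 1) * p" using assms(2) by simp
  moreover have "of_nat ((i + 1) * p) = (0::'a)" using assms(1)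
    by (metis of_nat_CHAR of_nat_mult mult_zero_right)
  ultimately show ?thesis by (simp only: coeff_formal_deriv) simp
qed

section \<open>Monic division and evaluation of polynomials\<close>

text \<open>Induction on \<open>n\<close>, cancelling the top coefficient of \<open>g\<close> by a
  multiple of \<open>f\<close>. Bounds by vanishing coefficients treat a zero quotient or remainder
  uniformly; the last clause records the top coefficient of the quotient.\<close>

lemma monic_division:
  fixes f g :: "'a::comm_ring_1 poly"
  assumes f: "degree f = r" "lead_coeff f = 1"
    and "\<And>i. n + r \<le> i \<Longrightarrow> coeff g i = 0"
  obtains q s where "g = q * f + s" "\<And>i. n \<le> i \<Longrightarrow> coeff q i = 0"
    "\<And>i. r \<le> i \<Longrightarrow> coeff s i = 0" "\<And>m. n = Suc m \<Longrightarrow> coeff q m = coeff g (m + r)"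
proof -
  have "\<exists>q s. g = q * f + s \<and> (\<forall>i\<ge>n. coeff q i = 0) \<and> (\<forall>i\<ge>r. coeff s i = 0) \<and>
      (\<forall>m. n = Suc m \<longrightarrow> coeff q m = coeff g (m + r))"
    using assms(3)
  proof (induction n arbitrary: g)
    case 0
    then show ?case by (intro exI[of _ 0] exI[of _ g]) auto
  next
    case (Suc n)
    define c where "c = coeff g (n + r)"
    define g' where "g' = g - monom c n * f"
    have "coeff g' i = 0" if "n + r \<le> i" for i
    proof (cases "i = n + r")
      case True
      then show ?thesis using f by (simp add: g'_def c_def coeff_monom_mult)
    next
      case False
      then have "coeff g i = 0" "coeff f (i - n) = 0"
        using that Suc.prems[of i] f by (auto intro: coeff_eq_0)
      then show ?thesis by (simp add: g'_def coeff_monom_mult)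
    qed
    from Suc.IH[OF this] obtain q s where qs: "g' = q * f + s" "\<forall>i\<ge>n. coeff q i = 0"
        "\<forall>i\<ge>r. coeff s i = 0" by blast
    show ?case
      using qs by (intro exI[of _ "q + monom c n"] exI[of _ s])
        (auto simp: g'_def c_def algebra_simps)
  qed
  then show ?thesis using that by blast
qed

lemma poly_sum_lessThan:
  fixes g :: "'a::comm_ring_1 poly"
  assumes "\<And>i. r \<le> i \<Longrightarrow> coeff g i = 0"
  shows "poly g c = (\<Sum>k<r. c ^ k * coeff g k)"
proof (cases "r = 0")
  case True
  then have "g = 0" using assms by (intro poly_eqI) auto
  then show ?thesis using True by simp
next
  case False
  then have "degree g < r" using assms
    by (metis degree_0 leading_coeff_0_iff linorder_not_less not_gr_zero)
  then have "(\<Sum>k<r. c ^ k * coeff g k) = (\<Sum>k\<le>degree g. c ^ k * coeff g k)"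
    by (intro sum.mono_neutral_right) (auto simp: coeff_eq_0)
  then show ?thesis by (simp add: poly_altdef mult.commute)
qed

lemma poly_sum_lessThan_reverse:
  fixes g :: "'a::comm_ring_1 poly"
  assumes "\<And>i. r \<le> i \<Longrightarrow> coeff g i = 0"
  shows "poly g c = (\<Sum>k<r. c ^ (r - Suc k) * coeff g (r - Suc k))"
proof -
  have "poly g c = (\<Sum>k<r. c ^ k * coeff g k)"
    by (rule poly_sum_lessThan) (rule assms)
  also have "\<dots> = (\<Sum>k<r. c ^ (r - Suc k) * coeff g (r - Suc k))"
    by (rule sum.nat_diff_reindex[where g = "\<lambda>k. c ^ k * coeff g k", symmetric])
  finally show ?thesis .
qed

section \<open>The matrix \<open>Mmat\<close> as a linear operator\<close>

lemma mat_mult_mat: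
  fixes f g :: "nat \<Rightarrow> nat \<Rightarrow> 'a::comm_ring_1"
  shows "mat n n (\<lambda>(i, j). f i j) * mat n n (\<lambda>(i, j). g i j)
    = mat n n (\<lambda>(i, j). \<Sum>k<n. f i k * g k j)"
  by (rule eq_matI) (auto simp: scalar_prod_def atLeast0LessThan)

text \<open>With 0-based indices the exponent is \<open>(i + 1) * p - 1\<close> minus
  \<open>d - Suc j\<close>, so column \<open>j\<close> is the image of
  \<open>X ^ (d - 1 - j)\<close>. The convention for negative indices agrees with the zero
  coefficients of a product with a monomial below its exponent.\<close>

lemma Mmat_entry:
  assumes "p > 0" "i < d" "j < d"
  shows "Mmat p d q $$ (i, j) = coeff (monom 1 (d - Suc j) * q) ((i + 1) * p - 1)"
proof -
  define k where "k = int ((i+1)*p + (j+1)) - int d - 1"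
  have k: "k = int ((i + 1) * p - 1) - int (d - Suc j)"
    using assms by (simp add: k_def of_nat_diff algebra_simps)
  have "k < 0 \<longleftrightarrow> (i + 1) * p - 1 < d - Suc j" and "nat k = (i + 1) * p - 1 - (d - Suc j)"
    unfolding k by linarith+
  moreover have "Mmat p d q $$ (i, j) = (if k < 0 then 0 else coeff q (nat k))"
    using assms by (simp add: Mmat_def Let_def k_def)
  ultimately show ?thesis
    by (simp add: coeff_monom_mult)
qed

text \<open>Linear extension of the description of the columns: on the coefficients of
  \<open>g\<close>, listed in descending order, the matrix acts as
  \<open>g \<mapsto> C (g q)\<close>.\<close>

lemma sum_Mmat_coeff:
  assumes "p > 0" "i < d" "\<And>l. d \<le> l \<Longrightarrow> coeff g l = 0"
  shows "(\<Sum>k<d. Mmat p d q $$ (i, k) * coeff g (d - Suc k)) = coeff (g * q) ((i + 1) * p - 1)"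
proof -
  have g: "g = (\<Sum>k<d. monom (coeff g k) k)"
    by (rule poly_eqI) (use assms(3) in \<open>auto simp: coeff_sum\<close>)
  have "(\<Sum>k<d. Mmat p d q $$ (i, k) * coeff g (d - Suc k))
      = (\<Sum>k<d. coeff (monom (coeff g (d - Suc k)) (d - Suc k) * q) ((i + 1) * p - 1))"
    using assms(1,2) by (intro sum.cong) (auto simp: Mmat_entry coeff_monom_mult)
  also have "\<dots> = (\<Sum>k<d. coeff (monom (coeff g k) k * q) ((i + 1) * p - 1))"
    by (rule sum.nat_diff_reindex[where g = "\<lambda>k. coeff (monom (coeff g k) k * q) ((i + 1) * p - 1)"])
  also have "\<dots> = coeff ((\<Sum>k<d. monom (coeff g k) k) * q) ((i + 1) * p - 1)"
    by (simp add: coeff_sum sum_distrib_right)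
  finally show ?thesis by (simp flip: g)
qed

section \<open>Products of linear factors and Vandermonde determinants\<close>

lemma coeff_prod_linear:
  fixes a :: "'b \<Rightarrow> 'a::comm_ring_1"
  assumes "finite S"
  shows "coeff (\<Prod>i\<in>S. [:- a i, 1:]) (card S) = 1"
    and "card S < l \<Longrightarrow> coeff (\<Prod>i\<in>S. [:- a i, 1:]) l = 0"
proof -
  have "coeff (\<Prod>i\<in>S. [:- a i, 1:]) (card S) = 1 \<and> (\<forall>l>card S. coeff (\<Prod>i\<in>S. [:- a i, 1:]) l = 0)"
    using assms
  proof (induction S rule: finite_induct)
    case (insert s S)
    then show ?case
      by (auto simp: coeff_pCons coeff_eq_0 split: nat.splits)
  qed simp
  then show "coeff (\<Prod>i\<in>S. [:- a i, 1:]) (card S) = 1"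
    and "card S < l \<Longrightarrow> coeff (\<Prod>i\<in>S. [:- a i, 1:]) l = 0" by auto
qed

lemma det_lower_triangular_mat:
  fixes f :: "nat \<Rightarrow> nat \<Rightarrow> 'a::comm_ring_1"
  assumes "\<And>i j. i < j \<Longrightarrow> j < n \<Longrightarrow> f i j = 0"
  shows "det (mat n n (\<lambda>(i, j). f i j)) = (\<Prod>i<n. f i i)"
  using assms
  by (subst det_lower_triangular[where n = n])
    (auto simp: prod_list_diag_prod atLeast0LessThan)

lemma det_upper_triangular_mat:
  fixes f :: "nat \<Rightarrow> nat \<Rightarrow> 'a::comm_ring_1"
  assumes "\<And>i j. j < i \<Longrightarrow> i < n \<Longrightarrow> f i j = 0"
  shows "det (mat n n (\<lambda>(i, j). f i j)) = (\<Prod>i<n. f i i)"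
  using assms
  by (subst det_upper_triangular[where n = n])
    (auto simp: prod_list_diag_prod atLeast0LessThan)

lemma det_mat_mult:
  fixes f g :: "nat \<Rightarrow> nat \<Rightarrow> 'a::comm_ring_1"
  shows "det (mat n n (\<lambda>(i, j). f i j)) * det (mat n n (\<lambda>(i, j). g i j))
    = det (mat n n (\<lambda>(i, j). \<Sum>k<n. f i k * g k j))"
  unfolding mat_mult_mat[symmetric] by (rule det_mult[symmetric]) auto

text \<open>Evaluation at the points \<open>a i\<close> factors through the coefficients. Two
  versions are given because \<open>Mmat\<close> takes coefficients in descending order while its
  values come out in ascending order.\<close>

lemma det_vandermonde_mult:
  fixes a :: "nat \<Rightarrow> 'a::comm_ring_1"
  assumes "\<And>i j. j < r \<Longrightarrow> r \<le> i \<Longrightarrow> coeff (g j) i = 0"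
  shows "det (mat r r (\<lambda>(i, j). a i ^ j)) * det (mat r r (\<lambda>(i, j). coeff (g j) i))
      = det (mat r r (\<lambda>(i, j). poly (g j) (a i)))"
    and "det (mat r r (\<lambda>(i, j). a i ^ (r - Suc j))) * det (mat r r (\<lambda>(i, j). coeff (g j) (r - Suc i)))
      = det (mat r r (\<lambda>(i, j). poly (g j) (a i)))"
proof -
  have "(\<Sum>k<r. a i ^ k * coeff (g j) k) = poly (g j) (a i)"
    if "j < r" for i j
    by (rule poly_sum_lessThan[symmetric]) (rule assms[OF that])
  moreover have "(\<Sum>k<r. a i ^ (r - Suc k) * coeff (g j) (r - Suc k)) = poly (g j) (a i)"
    if "j < r" for i j
    by (rule poly_sum_lessThan_reverse[symmetric]) (rule assms[OF that])
  ultimately show "det (mat r r (\<lambda>(i, j). a i ^ j)) * det (mat r r (\<lambda>(i, j). coeff (g j) i))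
      = det (mat r r (\<lambda>(i, j). poly (g j) (a i)))"
    and "det (mat r r (\<lambda>(i, j). a i ^ (r - Suc j))) * det (mat r r (\<lambda>(i, j). coeff (g j) (r - Suc i)))
      = det (mat r r (\<lambda>(i, j). poly (g j) (a i)))"
    unfolding det_mat_mult by (auto intro!: arg_cong[where f = det] eq_matI)
qed

text \<open>In the Newton basis \<open>\<Prod>m<j. X - a m\<close> the coefficient matrix is
  unitriangular and the evaluation matrix is triangular, so the diagonal of the latter gives the
  determinant.\<close>

lemma det_vandermonde:
  fixes a :: "nat \<Rightarrow> 'a::comm_ring_1"
  shows "det (mat r r (\<lambda>(i, j). a i ^ j)) = (\<Prod>i<r. \<Prod>j<i. a i - a j)"
proof -
  let ?g = "\<lambda>j. \<Prod>m<j. [:- a m, 1:]"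
  have z: "coeff (?g j) i = 0" if "j < i" for i j
    using coeff_prod_linear(2)[of "{..<j}" i a] that by simp
  have "det (mat r r (\<lambda>(i, j). coeff (?g j) i)) = (\<Prod>i<r. coeff (?g i) i)"
    by (rule det_upper_triangular_mat) (rule z)
  also have "\<dots> = 1"
    using coeff_prod_linear(1)[of "{..<_}" a] by simp
  finally have "det (mat r r (\<lambda>(i, j). a i ^ j)) = det (mat r r (\<lambda>(i, j). poly (?g j) (a i)))"
    using det_vandermonde_mult(1)[of r ?g a] z by simp
  also have "\<dots> = (\<Prod>i<r. poly (?g i) (a i))"
    by (rule det_lower_triangular_mat) (auto simp: poly_prod intro!: prod_zero)
  finally show ?thesis by (simp add: poly_prod)
qed

lemma det_vandermonde_reverse:
  fixes a :: "nat \<Rightarrow> 'a::comm_ring_1"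
  shows "det (mat r r (\<lambda>(i, j). a i ^ (r - Suc j))) = (\<Prod>i<r. \<Prod>j\<in>{i<..<r}. a i - a j)"
proof -
  let ?g = "\<lambda>j. \<Prod>m\<in>{j<..<r}. [:- a m, 1:]"
  have z: "coeff (?g j) i = 0" if "r \<le> i + j" "j < r" for i j
    using coeff_prod_linear(2)[of "{j<..<r}" i a] that by simp
  have "det (mat r r (\<lambda>(i, j). coeff (?g j) (r - Suc i))) = (\<Prod>i<r. coeff (?g i) (r - Suc i))"
    by (rule det_lower_triangular_mat) (rule z, auto)
  also have "\<dots> = 1"
    using coeff_prod_linear(1)[of "{_<..<r}" a] by simp
  finally have "det (mat r r (\<lambda>(i, j). a i ^ (r - Suc j))) = det (mat r r (\<lambda>(i, j). poly (?g j) (a i)))"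
    using det_vandermonde_mult(2)[of r ?g a] z by simp
  also have "\<dots> = (\<Prod>i<r. poly (?g i) (a i))"
    by (rule det_upper_triangular_mat) (auto simp: poly_prod intro!: prod_zero)
  finally show ?thesis by (simp add: poly_prod)
qed

lemma vandermonde_product_sign:
  fixes a :: "nat \<Rightarrow> 'a::comm_ring_1"
  shows "(\<Prod>i<r. \<Prod>j<i. a i - a j) = (-1) ^ (r * (r - 1) div 2) * (\<Prod>i<r. \<Prod>j\<in>{i<..<r}. a i - a j)"
proof (induction r)
  case (Suc r)
  have "(\<Prod>i<Suc r. \<Prod>j\<in>{i<..<Suc r}. a i - a j) = (\<Prod>i<r. \<Prod>j\<in>{i<..<Suc r}. a i - a j)"
    by (simp add: atLeastSucLessThan_greaterThanLessThan[symmetric])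
  also have "\<dots> = (\<Prod>i<r. (a i - a r) * (\<Prod>j\<in>{i<..<r}. a i - a j))"
  proof (rule prod.cong)
    fix i assume "i \<in> {..<r}"
    then have "{i<..<Suc r} = insert r {i<..<r}" by auto
    then show "(\<Prod>j\<in>{i<..<Suc r}. a i - a j) = (a i - a r) * (\<Prod>j\<in>{i<..<r}. a i - a j)"
      by simp
  qed simp
  finally have d: "(\<Prod>i<Suc r. \<Prod>j\<in>{i<..<Suc r}. a i - a j)
      = (\<Prod>i<r. a i - a r) * (\<Prod>i<r. \<Prod>j\<in>{i<..<r}. a i - a j)"
    by (simp add: prod.distrib)
  have "(\<Prod>j<r. a r - a j) = (\<Prod>j<r. - 1 * (a j - a r))" by simp
  also have "\<dots> = (-1) ^ r * (\<Prod>j<r. a j - a r)" by (subst prod.distrib) simp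
  finally have e: "(\<Prod>j<r. a r - a j) = (-1) ^ r * (\<Prod>j<r. a j - a r)" .
  have "Suc r * (Suc r - 1) div 2 = r * (r - 1) div 2 + r"
    by (cases r) (simp_all add: algebra_simps)
  then show ?case unfolding d by (simp add: Suc.IH e power_add algebra_simps)
qed simp

text \<open>The left side is the product of the derivatives at the roots, which is the discriminant
  up to sign: each unordered pair occurs twice, with opposite signs.\<close>

lemma prod_differences:
  fixes a :: "nat \<Rightarrow> 'a::comm_ring_1"
  shows "(\<Prod>i<r. \<Prod>j\<in>{..<r} - {i}. a i - a j)
    = (-1) ^ (r * (r - 1) div 2) * (\<Prod>i<r. \<Prod>j\<in>{i<..<r}. a i - a j)\<^sup>2"
proof -
  have "(\<Prod>j\<in>{..<r} - {i}. a i - a j) = (\<Prod>j<i. a i - a j) * (\<Prod>j\<in>{i<..<r}. a i - a j)"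
    if "i < r" for i
    by (subst prod.union_disjoint[symmetric]) (use that in \<open>auto intro!: prod.cong\<close>)
  then have "(\<Prod>i<r. \<Prod>j\<in>{..<r} - {i}. a i - a j)
      = (\<Prod>i<r. (\<Prod>j<i. a i - a j) * (\<Prod>j\<in>{i<..<r}. a i - a j))"
    by (intro prod.cong) auto
  then show ?thesis
    by (simp add: prod.distrib vandermonde_product_sign power2_eq_square)
qed

section \<open>Zero-based forms of \<open>fpoly\<close> and \<open>delta\<close>\<close>

lemma fpoly_lessThan: "fpoly r x = (\<Prod>i<r. [:- x (Suc i), 1:])"
  unfolding fpoly_def
  by (rule prod.reindex_bij_witness[of _ Suc "\<lambda>i. i - 1"]) auto

lemma delta_lessThan: "delta r x = (\<Prod>i<r. \<Prod>j\<in>{i<..<r}. x (Suc i) - x (Suc j))"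
proof -
  have "(\<Prod>j\<in>{Suc i + 1..r}. x (Suc i) - x j) = (\<Prod>j\<in>{i<..<r}. x (Suc i) - x (Suc j))" for i
    by (rule prod.reindex_bij_witness[of _ Suc "\<lambda>i. i - 1"]) auto
  then have "(\<Prod>i<r. \<Prod>j\<in>{i<..<r}. x (Suc i) - x (Suc j)) = (\<Prod>i<r. \<Prod>j\<in>{Suc i + 1..r}. x (Suc i) - x j)"
    by simp
  also have "\<dots> = delta r x"
    unfolding delta_def by (rule prod.reindex_bij_witness[of _ "\<lambda>i. i - 1" Suc]) auto
  finally show ?thesis ..
qed

section \<open>Frobenius and the case \<open>e = p - 1\<close>, \<open>d = r\<close>\<close>

lemma det_mat_power_CHAR:
  fixes f :: "nat \<Rightarrow> nat \<Rightarrow> 'a::comm_ring_1"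
  assumes "prime p" "CHAR('a) = p"
  shows "det (mat n n (\<lambda>(i, j). f i j ^ p)) = det (mat n n (\<lambda>(i, j). f i j)) ^ p"
proof -
  have "p > 0" using assms(1) by (rule prime_gt_0_nat)
  interpret frob: comm_ring_hom "\<lambda>y::'a. y ^ p"
    by unfold_locales
      (use assms \<open>p > 0\<close> in \<open>auto simp: power_mult_distrib freshmans_dream power_0_left\<close>)
  have "mat n n (\<lambda>(i, j). f i j ^ p) = map_mat (\<lambda>y. y ^ p) (mat n n (\<lambda>(i, j). f i j))"
    by (rule eq_matI) auto
  then show ?thesis by (simp only: frob.hom_det)
qed

text \<open>\<open>q ^ p\<close> has only exponents divisible by \<open>p\<close>, with coefficients
  raised to the power \<open>p\<close>. As \<open>s\<close> has degree below \<open>p\<close>, only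
  the term at \<open>i * p\<close> can reach the exponent \<open>(i + 1) * p - 1\<close>, through
  the coefficient of \<open>s\<close> at \<open>p - 1\<close>.\<close>

lemma coeff_power_CHAR_mult:
  fixes q s :: "'a::comm_ring_1 poly"
  assumes "prime p" "CHAR('a) = p" and s: "\<And>l. p \<le> l \<Longrightarrow> coeff s l = 0"
  shows "coeff (q ^ p * s) ((i + 1) * p - 1) = coeff q i ^ p * coeff s (p - 1)"
proof -
  have p: "p > 0" using assms(1) by (rule prime_gt_0_nat)
  have "q ^ p = (\<Sum>l\<le>degree q. monom (coeff q l) l) ^ p"
    by (simp add: poly_as_sum_of_monoms)
  also have "\<dots> = (\<Sum>l\<le>degree q. monom (coeff q l ^ p) (l * p))"
    using assms(1,2) by (subst freshmans_dream_sum) (auto simp: monom_power)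
  finally have "coeff (q ^ p * s) ((i + 1) * p - 1)
      = (\<Sum>l\<le>degree q. coeff (monom (coeff q l ^ p) (l * p) * s) ((i + 1) * p - 1))"
    by (simp add: sum_distrib_right coeff_sum)
  also have "\<dots> = (\<Sum>l\<le>degree q. if l = i then coeff q i ^ p * coeff s (p - 1) else 0)"
  proof (rule sum.cong)
    fix l
    consider "l < i" | "l = i" | "i < l" by linarith
    then show "coeff (monom (coeff q l ^ p) (l * p) * s) ((i + 1) * p - 1)
        = (if l = i then coeff q i ^ p * coeff s (p - 1) else 0)"
    proof cases
      case 1
      then have "(l + 1) * p \<le> i * p" by (intro mult_right_mono) auto
      then have "p \<le> (i + 1) * p - 1 - l * p" using p by simp
      then show ?thesis using 1 s by (simp add: coeff_monom_mult)
    next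
      case 2
      then show ?thesis using p by (simp add: coeff_monom_mult)
    next
      case 3
      then have "(i + 1) * p \<le> l * p" by (intro mult_right_mono) auto
      then have "(i + 1) * p - 1 < l * p" using p by simp
      then show ?thesis using 3 by (simp add: coeff_monom_mult)
    qed
  qed simp
  also have "\<dots> = coeff q i ^ p * coeff s (p - 1)"
    using p by (simp add: coeff_eq_0 power_0_left not_le)
  finally show ?thesis .
qed

lemma Mmat_carrier [simp]:
  "Mmat p d q \<in> carrier_mat d d" "dim_row (Mmat p d q) = d" "dim_col (Mmat p d q) = d"
  by (simp_all add: Mmat_def)

lemma mat_Mmat: "mat d d (\<lambda>(i, j). Mmat p d q $$ (i, j)) = Mmat p d q"
  by (rule eq_matI) simp_all

lemma Mmat_Suc_Suc:
  assumes "p > 0" "i < d" "j < d"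
  shows "Mmat p (Suc d) q $$ (i, Suc j) = Mmat p d q $$ (i, j)"
  using assms by (simp add: Mmat_entry)

text \<open>The Lagrange-type basis \<open>\<Prod>m\<noteq>j. X - x m\<close> is sent to its Frobenius twist.\<close>

lemma det_Mmat_fpoly_pred:
  fixes x :: "nat \<Rightarrow> 'a::comm_ring_1"
  assumes "prime p" "CHAR('a) = p" and inj: "inj ((*) (delta r x))"
  shows "det (Mmat p r (fpoly r x ^ (p - 1))) = (-1) ^ (r * (r - 1) div 2) * delta r x ^ (p - 1)"
proof -
  define a where "a i = x (Suc i)" for i
  define s where "s = (-1 :: 'a) ^ (r * (r - 1) div 2)"
  define \<delta> where "\<delta> = delta r x"
  define g where "g j = (\<Prod>m\<in>{..<r} - {j}. [:- a m, 1:])" for j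
  have p: "p > 0" using assms(1) by (rule prime_gt_0_nat)
  have cancel: "u = v" if "\<delta> * u = \<delta> * v" for u v
    using injD[OF inj, of u v] that by (simp add: \<delta>_def)
  have \<delta>: "\<delta> = (\<Prod>i<r. \<Prod>j\<in>{i<..<r}. a i - a j)"
    by (simp add: \<delta>_def delta_lessThan a_def)
  have ss: "s * s = 1" by (simp add: s_def flip: power_mult_distrib)
  have g0: "coeff (g j) i = 0" if "j < r" "r \<le> i" for i j
    using coeff_prod_linear(2)[of "{..<r} - {j}" i a] that by (simp add: g_def)
  have "coeff (g j * fpoly r x ^ (p - 1)) ((i + 1) * p - 1) = coeff (g j) i ^ p" if "j < r" for i j
  proof -
    \<comment> \<open>Since \<open>f\<close> is \<open>g j\<close> times \<open>X - a j\<close>, the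
      product below becomes \<open>g j ^ p\<close> times a power of \<open>X - a j\<close> that is
      monic of degree exactly \<open>p - 1\<close>.\<close>
    have "fpoly r x = g j * [:- a j, 1:]"
      unfolding fpoly_lessThan g_def a_def using that
      by (subst prod.remove[of "{..<r}" j]) (auto simp: mult.commute)
    then have "g j * fpoly r x ^ (p - 1) = g j ^ p * [:- a j, 1:] ^ (p - 1)"
      by (simp only: power_mult_distrib power_minus_mult[OF p, symmetric]) (simp only: mult_ac)
    moreover have "coeff ([:- a j, 1:] ^ (p - 1)) (p - 1) = 1"
      using coeff_prod_linear(1)[of "{..<p - 1}" "\<lambda>_. a j"] by simp
    moreover have "coeff ([:- a j, 1:] ^ (p - 1)) l = 0" if "p \<le> l" for l
      using coeff_prod_linear(2)[of "{..<p - 1}" l "\<lambda>_. a j"] that p by simp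
    ultimately show ?thesis
      using coeff_power_CHAR_mult[OF assms(1,2), of "[:- a j, 1:] ^ (p - 1)" "g j" i] by simp
  qed
  then have "det (Mmat p r (fpoly r x ^ (p - 1))) * det (mat r r (\<lambda>(i, j). coeff (g j) (r - Suc i)))
      = det (mat r r (\<lambda>(i, j). coeff (g j) i ^ p))"
    by (subst mat_Mmat[symmetric], subst det_mat_mult, use p g0 in \<open>auto intro!: arg_cong[where f = det] eq_matI simp: sum_Mmat_coeff\<close>)
  then have M: "det (Mmat p r (fpoly r x ^ (p - 1))) * det (mat r r (\<lambda>(i, j). coeff (g j) (r - Suc i)))
      = det (mat r r (\<lambda>(i, j). coeff (g j) i)) ^ p"
    by (simp only: det_mat_power_CHAR[OF assms(1,2)])
  have "det (mat r r (\<lambda>(i, j). poly (g j) (a i))) = (\<Prod>i<r. poly (g i) (a i))"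
    by (rule det_lower_triangular_mat) (auto simp: g_def poly_prod intro!: prod_zero)
  also have "\<dots> = s * \<delta>\<^sup>2"
    by (simp add: g_def poly_prod prod_differences s_def \<delta>)
  finally have diag: "det (mat r r (\<lambda>(i, j). poly (g j) (a i))) = s * \<delta>\<^sup>2" .
  \<comment> \<open>Dividing the diagonal determinant by the two Vandermonde determinants gives
    \<open>\<delta>\<close> for ascending and \<open>s * \<delta>\<close> for descending
    coefficients; \<open>s\<close> is the sign of reversing the rows.\<close>
  have "s * \<delta> * det (mat r r (\<lambda>(i, j). coeff (g j) i)) = s * \<delta>\<^sup>2"
    using det_vandermonde_mult(1)[of r g a, OF g0] diag
    by (simp add: det_vandermonde vandermonde_product_sign s_def \<delta>)
  then have "s * (s * \<delta> * det (mat r r (\<lambda>(i, j). coeff (g j) i))) = s * (s * \<delta>\<^sup>2)" by simp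
  then have "\<delta> * det (mat r r (\<lambda>(i, j). coeff (g j) i)) = \<delta> * \<delta>"
    by (simp add: mult.assoc[symmetric] ss power2_eq_square)
  then have asc: "det (mat r r (\<lambda>(i, j). coeff (g j) i)) = \<delta>" by (rule cancel)
  have "\<delta> * det (mat r r (\<lambda>(i, j). coeff (g j) (r - Suc i))) = \<delta> * (s * \<delta>)"
    using det_vandermonde_mult(2)[of r g a, OF g0] diag
    by (simp add: det_vandermonde_reverse \<delta> power2_eq_square mult_ac)
  then have desc: "det (mat r r (\<lambda>(i, j). coeff (g j) (r - Suc i))) = s * \<delta>" by (rule cancel)
  have "\<delta> * det (Mmat p r (fpoly r x ^ (p - 1))) = s * (s * \<delta> * det (Mmat p r (fpoly r x ^ (p - 1))))"
    by (simp add: mult.assoc[symmetric] ss)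
  also have "s * \<delta> * det (Mmat p r (fpoly r x ^ (p - 1))) = \<delta> ^ p"
    using M by (simp add: asc desc mult_ac)
  also have "s * \<delta> ^ p = \<delta> * (s * \<delta> ^ (p - 1))"
    by (simp only: power_minus_mult[OF p, symmetric]) (simp only: mult_ac)
  finally show ?thesis unfolding \<delta>_def s_def by (rule cancel[unfolded \<delta>_def])
qed

section \<open>Passing from \<open>d\<close> to \<open>d - 1\<close>\<close>

text \<open>Entry \<open>j\<close> of the last row is the coefficient at
  \<open>d * (p - 1) + j\<close>, which is 1 for \<open>j = 0\<close> and 0 beyond. Deleting that
  row and the first column leaves the matrix of size \<open>d - 1\<close>, because the shift of the
  column index absorbs the change of \<open>d\<close>.\<close>

lemma det_Mmat_monic_top:
  assumes "p > 0" "d > 0" "coeff q (d * (p - 1)) = 1" "\<And>l. d * (p - 1) < l \<Longrightarrow> coeff q l = 0"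
  shows "det (Mmat p d q) = (-1) ^ (d + 1) * det (Mmat p (d - 1) q)"
proof -
  obtain n where d: "d = Suc n" using assms(2) by (cases d) auto
  let ?A = "Mmat p (Suc n) q"
  have A: "?A \<in> carrier_mat (Suc n) (Suc n)" by simp
  have "?A $$ (n, j) = (if j = 0 then 1 else 0)" if "j < Suc n" for j
  proof -
    obtain m where m: "p = Suc m" using assms(1) by (cases p) auto
    have "(n + 1) * p - 1 - (n - j) = d * (p - 1) + j" and "n - j \<le> (n + 1) * p - 1"
      using that by (simp_all add: m d)
    then show ?thesis
      using that assms by (auto simp: Mmat_entry coeff_monom_mult d)
  qed
  then have "det ?A = cofactor ?A n 0"
    by (subst laplace_expansion_row[OF A, of n]) (simp_all add: sum.lessThan_Suc_shift del: sum.lessThan_Suc)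
  moreover have "mat_delete ?A n 0 = Mmat p n q"
    using assms(1) by (intro eq_matI) (auto simp: mat_delete_def Mmat_Suc_Suc)
  ultimately show ?thesis by (simp add: cofactor_def d)
qed

section \<open>Passing from \<open>e\<close> to \<open>e - 1\<close>\<close>

text \<open>Lets a matrix be bordered by one row and column without changing its
  determinant.\<close>

lemma det_first_row_unit:
  fixes F :: "nat \<Rightarrow> nat \<Rightarrow> 'a::comm_ring_1"
  assumes "\<And>j. F 0 j = (if j = 0 then 1 else 0)"
  shows "det (mat (Suc d) (Suc d) (\<lambda>(i, j). F i j)) = det (mat d d (\<lambda>(i, j). F (Suc i) (Suc j)))"
proof -
  let ?A = "mat (Suc d) (Suc d) (\<lambda>(i, j). F i j)"
  have "det ?A = cofactor ?A 0 0"
    using assms by (subst laplace_expansion_row[of _ "Suc d" 0])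
      (simp_all add: sum.lessThan_Suc_shift del: sum.lessThan_Suc)
  moreover have "mat_delete ?A 0 0 = mat d d (\<lambda>(i, j). F (Suc i) (Suc j))"
    by (rule eq_matI) (auto simp: mat_delete_def)
  ultimately show ?thesis by (simp add: cofactor_def)
qed

lemma poly_formal_deriv_fpoly:
  assumes "i < r"
  shows "poly (formal_deriv (fpoly r x)) (x (Suc i)) = (\<Prod>j\<in>{..<r} - {i}. x (Suc i) - x (Suc j))"
proof -
  have "fpoly r x = [:- x (Suc i), 1:] * (\<Prod>j\<in>{..<r} - {i}. [:- x (Suc j), 1:])"
    unfolding fpoly_lessThan using assms by (subst prod.remove[of "{..<r}" i]) auto
  then show ?thesis
    by (simp only: formal_deriv_mult) (simp add: formal_deriv_pCons poly_prod)
qed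

text \<open>For \<open>h = X ^ (d - j)\<close> divide \<open>e h f' = q f + s\<close>. Since \<open>(h f ^ e)'\<close> has vanishing coefficients at
  the exponents \<open>(i + 1) p - 1\<close>, the matrix of \<open>f ^ (e - 1)\<close> applied to \<open>s\<close> equals the matrix of \<open>f ^ e\<close> applied
  to \<open>D = - (q + h')\<close>. In the basis of the roots of \<open>f\<close>, the map \<open>h \<mapsto> s\<close> is multiplication by
  \<open>e f'\<close>, and \<open>h \<mapsto> D\<close> is triangular.\<close>

lemma det_Mmat_fpoly_step:
  fixes x :: "nat \<Rightarrow> 'a::comm_ring_1"
  assumes "prime p" "CHAR('a) = p" and inj: "inj ((*) (delta (Suc d) x))"
  shows "det (Mmat p d (fpoly (Suc d) x ^ n)) *
      (of_nat (Suc n) ^ Suc d * ((-1) ^ (Suc d * d div 2) * (delta (Suc d) x)\<^sup>2))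
    = (\<Prod>m<Suc d. of_nat (Suc n * Suc d + m)) * det (Mmat p d (fpoly (Suc d) x ^ Suc n))"
proof -
  define r e where "r = Suc d" and "e = Suc n"
  define a where "a i = x (Suc i)" for i
  define f where "f = fpoly r x"
  define h :: "nat \<Rightarrow> 'a poly" where "h j = monom 1 (d - j)" for j
  define \<delta> where "\<delta> = delta r x"
  have p: "p > 0" using assms(1) by (rule prime_gt_0_nat)
  have \<delta>: "\<delta> = (\<Prod>i<r. \<Prod>j\<in>{i<..<r}. a i - a j)"
    by (simp add: \<delta>_def delta_lessThan a_def)
  have cancel: "u = v" if "\<delta> * u = \<delta> * v" for u v
    using injD[OF inj, of u v] that by (simp add: \<delta>_def r_def)
  have f1: "coeff f r = 1" and f0: "\<And>l. r < l \<Longrightarrow> coeff f l = 0"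
    unfolding f_def fpoly_lessThan
    using coeff_prod_linear[where S = "{..<r}" and a = "\<lambda>i. x (Suc i)"] by simp_all
  have "(1::'a) \<noteq> 0" using assms by (metis CHAR_not_1' of_nat_1 of_nat_eq_0_iff_char_dvd not_prime_unit)
  then have deg_f: "degree f = r" "lead_coeff f = 1"
    using f0 f1 le_degree[of f r] degree_le[of r f] by (auto intro: antisym)
  have "\<exists>q s. of_nat e * h j * formal_deriv f = q * f + s \<and> (\<forall>i\<ge>d - j. coeff q i = 0)
      \<and> (\<forall>i\<ge>r. coeff s i = 0) \<and> (j < d \<longrightarrow> coeff q (d - Suc j) = of_nat (e * r))" for j
  proof -
    have c: "coeff (of_nat e * h j * formal_deriv f) (d - j + i) = of_nat e * coeff (formal_deriv f) i" for i
      by (simp add: h_def mult.assoc coeff_monom_mult of_nat_poly)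
    have z: "coeff (of_nat e * h j * formal_deriv f) i = 0" if "d - j + r \<le> i" for i
      using c[of "i - (d - j)"] that f0[of "Suc (i - (d - j))"] by (simp add: coeff_formal_deriv)
    show ?thesis
    proof (rule monic_division[OF deg_f, of "d - j" "of_nat e * h j * formal_deriv f"])
      fix q s
      assume qs: "of_nat e * h j * formal_deriv f = q * f + s" "\<And>i. d - j \<le> i \<Longrightarrow> coeff q i = 0"
        "\<And>i. r \<le> i \<Longrightarrow> coeff s i = 0"
        "\<And>m. d - j = Suc m \<Longrightarrow> coeff q m = coeff (of_nat e * h j * formal_deriv f) (m + r)"
      have "coeff q (d - Suc j) = of_nat (e * r)" if "j < d"
      proof -
        have "d - Suc j + r = d - j + d" using that by (simp add: r_def)
        then have "coeff q (d - Suc j) = of_nat e * coeff (formal_deriv f) d"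
          using qs(4)[of "d - Suc j"] c[of d] that by simp
        then show ?thesis using f1 by (simp add: coeff_formal_deriv r_def algebra_simps)
      qed
      then show ?thesis using qs by blast
    qed (use z in auto)
  qed
  then obtain q s where div: "\<And>j. of_nat e * h j * formal_deriv f = q j * f + s j"
    and q0: "\<And>j i. d - j \<le> i \<Longrightarrow> coeff (q j) i = 0"
    and s0: "\<And>j i. r \<le> i \<Longrightarrow> coeff (s j) i = 0"
    and q1: "\<And>j. j < d \<Longrightarrow> coeff (q j) (d - Suc j) = of_nat (e * r)"
    by metis
  define D where "D j = - (q j + formal_deriv (h j))" for j
  have D0: "coeff (D j) i = 0" if "d - j \<le> i" for i j
    using q0[OF that] that by (simp add: D_def h_def coeff_formal_deriv)
  have D1: "coeff (D j) (d - Suc j) = - of_nat (e * r + (d - j))" if "j < d" for j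
    using q1[OF that] that by (simp add: D_def h_def coeff_formal_deriv Suc_diff_Suc)
  have key: "coeff (s j * f ^ n) ((i + 1) * p - 1) = coeff (D j * f ^ e) ((i + 1) * p - 1)" for i j
  proof -
    have "formal_deriv (h j * f ^ e) = formal_deriv (h j) * f ^ e + of_nat e * h j * formal_deriv f * f ^ n"
      unfolding e_def by (simp only: formal_deriv_mult formal_deriv_power_Suc) (simp only: mult_ac)
    also have "\<dots> = s j * f ^ n - D j * f ^ e"
      by (simp only: div) (simp add: D_def e_def algebra_simps)
    finally have "coeff (s j * f ^ n - D j * f ^ e) ((i + 1) * p - 1) = 0"
      using coeff_formal_deriv_CHAR[OF assms(2) p, of "h j * f ^ e" i] by simp
    then show ?thesis by simp
  qed
  \<comment> \<open>\<open>s j\<close> has \<open>r = d + 1\<close> coefficients, while the matrices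
    to be compared have size \<open>d\<close>. Both are bordered by a first row that reads the top
    coefficient of \<open>s j\<close>; below it, \<open>A\<close> keeps the first \<open>d\<close>
    rows of \<open>Mmat p r (f ^ n)\<close>. \<open>E\<close> stacks that coefficient on those of
    \<open>D j\<close>.\<close>
  define A where "A i k = (case i of 0 \<Rightarrow> if k = 0 then 1 else 0
      | Suc i \<Rightarrow> Mmat p r (f ^ n) $$ (i, k))" for i k
  define B where "B i k = (case i of 0 \<Rightarrow> if k = 0 then 1 else 0
      | Suc i \<Rightarrow> case k of 0 \<Rightarrow> 0 | Suc k \<Rightarrow> Mmat p d (f ^ e) $$ (i, k))" for i k
  define E where "E k j = (case k of 0 \<Rightarrow> coeff (s j) d | Suc k \<Rightarrow> coeff (D j) (d - Suc k))" for k j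
  have detA: "det (mat r r (\<lambda>(i, j). A i j)) = det (Mmat p d (f ^ n))"
    unfolding r_def
    by (subst det_first_row_unit, simp add: A_def, rule arg_cong[where f = det], rule eq_matI)
      (auto simp: A_def r_def Mmat_Suc_Suc p)
  have detB: "det (mat r r (\<lambda>(i, j). B i j)) = det (Mmat p d (f ^ e))"
    unfolding r_def
    by (subst det_first_row_unit, simp add: B_def, rule arg_cong[where f = det], rule eq_matI)
      (auto simp: B_def)
  have "(\<Sum>k<r. A i k * coeff (s j) (r - Suc k)) = (\<Sum>k<r. B i k * E k j)" if "i < r" for i j
  proof (cases i)
    case 0
    then show ?thesis
      by (simp add: A_def B_def E_def r_def sum.lessThan_Suc_shift del: sum.lessThan_Suc)
  next
    case (Suc i')
    then have i: "i' < d" "i' < r" using that by (auto simp: r_def)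
    have "(\<Sum>k<r. A i k * coeff (s j) (r - Suc k)) = coeff (s j * f ^ n) ((i' + 1) * p - 1)"
      using sum_Mmat_coeff[OF p i(2), of "s j" "f ^ n"] s0 by (simp add: A_def Suc)
    moreover have "(\<Sum>k<r. B i k * E k j) = coeff (D j * f ^ e) ((i' + 1) * p - 1)"
      using sum_Mmat_coeff[OF p i(1), of "D j" "f ^ e"] D0[of j]
      by (simp add: B_def E_def Suc r_def sum.lessThan_Suc_shift del: sum.lessThan_Suc)
    ultimately show ?thesis by (simp only: key)
  qed
  then have "det (mat r r (\<lambda>(i, j). A i j)) * det (mat r r (\<lambda>(i, j). coeff (s j) (r - Suc i)))
      = det (mat r r (\<lambda>(i, j). B i j)) * det (mat r r (\<lambda>(i, j). E i j))"
    unfolding det_mat_mult by (auto intro!: arg_cong[where f = det] eq_matI)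
  then have main: "det (Mmat p d (f ^ n)) * det (mat r r (\<lambda>(i, j). coeff (s j) (r - Suc i)))
      = det (Mmat p d (f ^ e)) * det (mat r r (\<lambda>(i, j). E i j))"
    by (simp only: detA detB)
  have detE: "det (mat r r (\<lambda>(i, j). E i j)) = (\<Prod>m<r. of_nat (e * r + m))"
  proof -
    let ?E = "mat r r (\<lambda>(i, j). E i j)"
    \<comment> \<open>For \<open>j = d\<close>, \<open>h j = 1\<close> and the quotient is zero, so
      \<open>D d = 0\<close> and \<open>s d = e f'\<close>: the last column of \<open>E\<close> has
      only its top entry \<open>e * r\<close>. The remaining minor is triangular, and its sign
      \<open>(-1) ^ d\<close> cancels that of the cofactor.\<close>
    have Ed: "?E $$ (k, d) = (if k = 0 then of_nat (e * r) else 0)" if "k < r" for k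
    proof (cases k)
      case 0
      have "q d = 0" using q0[of d] by (intro poly_eqI) simp
      then have "s d = of_nat e * formal_deriv f"
        using div[of d] by (simp add: h_def)
      then have "coeff (s d) d = of_nat (e * r)"
        using f1 by (simp add: of_nat_poly coeff_formal_deriv r_def algebra_simps)
      then show ?thesis using 0 by (simp add: E_def r_def)
    next
      case (Suc k')
      then show ?thesis using that D0[of d] by (simp add: E_def r_def)
    qed
    have "det ?E = (\<Sum>i<r. ?E $$ (i, d) * cofactor ?E i d)"
      by (rule laplace_expansion_column) (auto simp: r_def)
    also have "\<dots> = (\<Sum>i<r. if i = 0 then of_nat (e * r) * cofactor ?E 0 d else 0)"
      by (rule sum.cong) (use Ed in auto)
    also have "\<dots> = of_nat (e * r) * cofactor ?E 0 d" by (simp add: r_def)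
    also have "cofactor ?E 0 d = (-1) ^ d * det (mat d d (\<lambda>(i, j). coeff (D j) (d - Suc i)))"
    proof -
      have "mat_delete ?E 0 d = mat d d (\<lambda>(i, j). coeff (D j) (d - Suc i))"
        by (rule eq_matI) (auto simp: mat_delete_def r_def E_def)
      then show ?thesis by (simp add: cofactor_def)
    qed
    also have "det (mat d d (\<lambda>(i, j). coeff (D j) (d - Suc i))) = (\<Prod>j<d. - of_nat (e * r + (d - j)))"
    proof -
      have "det (mat d d (\<lambda>(i, j). coeff (D j) (d - Suc i))) = (\<Prod>j<d. coeff (D j) (d - Suc j))"
        by (rule det_lower_triangular_mat) (rule D0, auto)
      then show ?thesis by (simp add: D1)
    qed
    also have "\<dots> = (-1) ^ d * (\<Prod>j<d. of_nat (e * r + (d - j)))"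
      by (simp only: prod_uminus card_lessThan)
    also have "(\<Prod>j<d. of_nat (e * r + (d - j))) = (\<Prod>m<d. of_nat (e * r + Suc m) :: 'a)"
      by (rule prod.reindex_bij_witness[of _ "\<lambda>m. d - Suc m" "\<lambda>m. d - Suc m"])
        (auto simp: Suc_diff_Suc)
    finally have "det ?E = of_nat (e * r) * (\<Prod>m<d. of_nat (e * r + Suc m))"
      by (simp add: mult.assoc[symmetric] flip: power_mult_distrib)
    then show ?thesis
      unfolding r_def by (simp only: prod.lessThan_Suc_shift) simp
  qed
  have detS: "det (mat r r (\<lambda>(i, j). coeff (s j) (r - Suc i)))
      = of_nat e ^ r * ((-1) ^ (r * (r - 1) div 2) * \<delta>\<^sup>2)"
  proof -
    \<comment> \<open>At a root the multiple of \<open>f\<close> drops out and \<open>s j\<close>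
      takes the value \<open>c i * a i ^ (d - j)\<close> with \<open>c i = e f'(a i)\<close>. The
      evaluation matrix is thus diagonal times Vandermonde, and \<open>\<delta>\<close>
      cancels.\<close>
    define c where "c i = of_nat e * (\<Prod>j\<in>{..<r} - {i}. a i - a j)" for i
    have ps: "poly (s j) (a i) = c i * a i ^ (r - Suc j)" if "i < r" for i j
    proof -
      have "poly f (a i) = 0"
        unfolding f_def fpoly_lessThan a_def poly_prod using that by (intro prod_zero) auto
      then have "poly (s j) (a i) = poly (of_nat e * h j * formal_deriv f) (a i)"
        unfolding div by simp
      also have "\<dots> = c i * a i ^ (r - Suc j)"
        using poly_formal_deriv_fpoly[OF that, of x]
        by (simp add: c_def f_def a_def h_def poly_monom r_def)
      finally show ?thesis .
    qed
    have "\<delta> * det (mat r r (\<lambda>(i, j). coeff (s j) (r - Suc i))) = det (mat r r (\<lambda>(i, j). poly (s j) (a i)))"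
      using det_vandermonde_mult(2)[of r s a] s0 by (simp add: det_vandermonde_reverse \<delta>)
    also have "\<dots> = det (mat r r (\<lambda>(i, j). \<Sum>k<r. (if k = i then c i else 0) * a k ^ (r - Suc j)))"
    proof (intro arg_cong[where f = det] eq_matI)
      fix i j assume "i < dim_row (mat r r (\<lambda>(i, j). \<Sum>k<r. (if k = i then c i else 0) * a k ^ (r - Suc j)))"
        "j < dim_col (mat r r (\<lambda>(i, j). \<Sum>k<r. (if k = i then c i else 0) * a k ^ (r - Suc j)))"
      then show "mat r r (\<lambda>(i, j). poly (s j) (a i)) $$ (i, j)
          = mat r r (\<lambda>(i, j). \<Sum>k<r. (if k = i then c i else 0) * a k ^ (r - Suc j)) $$ (i, j)"
        by (simp add: ps if_distrib[of "\<lambda>y. y * _"] cong: if_cong)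
    qed auto
    also have "\<dots> = det (mat r r (\<lambda>(i, k). if k = i then c i else 0)) * \<delta>"
      by (subst det_mat_mult[symmetric]) (simp add: det_vandermonde_reverse \<delta>)
    also have "det (mat r r (\<lambda>(i, k). if k = i then c i else 0)) = (\<Prod>i<r. c i)"
      by (subst det_lower_triangular_mat) auto
    also have "\<dots> = of_nat e ^ r * ((-1) ^ (r * (r - 1) div 2) * \<delta>\<^sup>2)"
      by (simp add: c_def prod.distrib prod_differences \<delta>)
    finally have "\<delta> * det (mat r r (\<lambda>(i, j). coeff (s j) (r - Suc i)))
        = \<delta> * (of_nat e ^ r * ((-1) ^ (r * (r - 1) div 2) * \<delta>\<^sup>2))"
      by (simp only: mult_ac)
    then show ?thesis by (rule cancel)
  qed
  show ?thesis
    using main[unfolded detE detS] unfolding f_def r_def e_def \<delta>_def diff_Suc_1 by (simp only: mult.commute)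
qed

section \<open>The unit row for powers of \<open>fpoly\<close>\<close>

lemma coeff_fpoly_power:
  fixes x :: "nat \<Rightarrow> 'a::comm_ring_1"
  shows "coeff (fpoly r x ^ e) (r * e) = 1" and "r * e < l \<Longrightarrow> coeff (fpoly r x ^ e) l = 0"
proof -
  have "fpoly r x ^ e = (\<Prod>i\<in>{1..r}. \<Prod>j\<in>{..<e}. [:- x i, 1:])"
    by (simp add: fpoly_def prod_power_distrib)
  also have "\<dots> = (\<Prod>ij\<in>{1..r} \<times> {..<e}. [:- x (fst ij), 1:])"
    by (simp only: prod.cartesian_product split_def)
  finally have "fpoly r x ^ e = (\<Prod>ij\<in>{1..r} \<times> {..<e}. [:- x (fst ij), 1:])" .
  then show "coeff (fpoly r x ^ e) (r * e) = 1" and "r * e < l \<Longrightarrow> coeff (fpoly r x ^ e) l = 0"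
    using coeff_prod_linear[where S = "{1..r} \<times> {..<e}" and a = "\<lambda>ij. x (fst ij)"] by simp_all
qed

lemma det_Mmat_fpoly_top:
  assumes "p > 0" "d > 0" "d * (p - 1) = r * e"
  shows "det (Mmat p d (fpoly r x ^ e)) = (-1) ^ (d + 1) * det (Mmat p (d - 1) (fpoly r x ^ e))"
  using assms coeff_fpoly_power by (intro det_Mmat_monic_top) auto

section \<open>Arithmetic of the constants modulo \<open>p\<close>\<close>

text \<open>\<open>c\<close> is invertible modulo \<open>p\<close>, hence its image is a unit even
  if the ring has zero divisors.\<close>

lemma of_nat_cancel_CHAR:
  fixes u v :: "'a::comm_ring_1"
  assumes "prime p" "CHAR('a) = p" "\<not> p dvd c" "of_nat c * u = of_nat c * v"
  shows "u = v"
proof -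
  have "coprime c p" using prime_imp_coprime[OF assms(1,3)] by (simp add: coprime_commute)
  then obtain c' where "[c * c' = Suc 0] (mod p)" using cong_solve_coprime_nat by blast
  then have "of_nat (c * c') = (of_nat (Suc 0) :: 'a)"
    using assms(2) by (simp only: of_nat_eq_iff_cong_CHAR)
  then have one: "of_nat c' * of_nat c = (1 :: 'a)" by (simp add: mult.commute)
  have "of_nat c' * (of_nat c * u) = of_nat c' * (of_nat c * v)" using assms(4) by simp
  then show ?thesis by (simp add: mult.assoc[symmetric] one)
qed

lemma fact_add_prod: "(\<Prod>m<r. N + r - m) * fact N = (fact (N + r) :: nat)"
proof (induction r)
  case (Suc r)
  have "(\<Prod>m<Suc r. N + Suc r - m) = (N + Suc r) * (\<Prod>m<r. N + r - m)"
    by (simp only: prod.lessThan_Suc_shift) simp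
  then have "(\<Prod>m<Suc r. N + Suc r - m) * fact N = (N + Suc r) * fact (N + r)"
    by (simp only: mult.assoc Suc.IH)
  then show ?case by simp
qed simp

text \<open>Derived from \<open>(-1) ^ p = -1\<close>, which also covers \<open>p = 2\<close>, where
  \<open>p - 1\<close> is odd but \<open>-1 = 1\<close>.\<close>

lemma minus_one_power_pred_CHAR:
  assumes "prime p" "CHAR('a::comm_ring_1) = p"
  shows "(-1 :: 'a) ^ (p - 1) = 1"
proof -
  have "(-1 :: 'a) ^ (p - 1) * -1 = (-1) ^ p"
    using assms(1) by (intro power_minus_mult prime_gt_0_nat)
  also have "\<dots> = -1" using minus_power_prime_CHAR[of p "1 :: 'a"] assms by simp
  finally show ?thesis by simp
qed

text \<open>Reduces the sign exponents of \<open>eps0\<close> to \<open>r * (r - 1) div 2\<close>,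
  the exponent produced by the Vandermonde identities.\<close>

lemma triangular_sign_shift:
  fixes r :: nat
  shows "(r + 1) * (r + 2) div 2 = r * (r - 1) div 2 + (2 * r + 1)"
    and "r * (r + 1) div 2 = r * (r - 1) div 2 + r"
proof -
  have h: "(r + 1) * (r + 2) = r * (r - 1) + 2 * (2 * r + 1)" "r * (r + 1) = r * (r - 1) + 2 * r"
    by (cases r; simp add: algebra_simps)+
  show "(r + 1) * (r + 2) div 2 = r * (r - 1) div 2 + (2 * r + 1)"
    unfolding h(1) by (subst div_mult_self2) simp_all
  show "r * (r + 1) div 2 = r * (r - 1) div 2 + r"
    unfolding h(2) by (subst div_mult_self2) simp_all
qed

text \<open>For \<open>e = p - 1\<close>, Wilson's theorem turns \<open>fact e ^ r\<close> into
  \<open>(-1) ^ r\<close>, and the other factorial is 1.\<close>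

lemma eps0_top:
  assumes "prime p" "CHAR('a::comm_ring_1) = p"
  shows "of_int (eps0 p r (p - 1)) = (-1 :: 'a) ^ (r + 1 + r * (r - 1) div 2)"
proof -
  have "[int (fact (p - 1)) = -1] (mod int p)"
    using wilson_theorem[OF assms(1)] by simp
  then have "of_int (int (fact (p - 1))) = (of_int (-1) :: 'a)"
    using assms(2) by (simp only: of_int_eq_iff_cong_CHAR)
  then have w: "of_int (fact (p - 1)) = (-1 :: 'a)" by simp
  have "(-1 :: 'a) ^ (r * (r + 1) div 2 * (p - 1)) = 1"
    by (simp only: mult.commute[of _ "p - 1"] power_mult minus_one_power_pred_CHAR[OF assms] power_one)
  then have "of_int (eps0 p r (p - 1)) = (-1 :: 'a) ^ ((r + 1) * (r + 2) div 2) * (-1) ^ r"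
    by (simp add: eps0_def power_add w[simplified])
  also have "\<dots> = (-1 :: 'a) ^ (r + 1 + r * (r - 1) div 2)"
    unfolding triangular_sign_shift by (simp add: power_add mult_ac)
  finally show ?thesis .
qed

text \<open>Mirrors the recursion in \<open>det_Mmat_fpoly_step\<close>; it holds over the integers
  once the factors \<open>e ^ r\<close> and \<open>fact (r * k)\<close> are cleared.\<close>

lemma eps0_step:
  assumes "Suc k \<le> p - 1"
  shows "eps0 p r (p - 1 - Suc k) * int ((p - 1 - k) ^ r * fact (r * k))
    = (-1) ^ (r * (r + 1) div 2) * int (fact (r * Suc k)) * eps0 p r (p - 1 - k)"
proof -
  define n t where "n = p - 1 - Suc k" and "t = r * (r + 1) div 2"
  have n: "p - 1 - k = Suc n" "p - 1 - n = Suc k" "p - 1 - Suc n = k"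
    using assms by (auto simp: n_def)
  define E where "E = (r + 1) * (r + 2) div 2"
  have e: "eps0 p r n = (-1) ^ (E + t * n) * int (fact (r * Suc k)) * int (fact n) ^ r"
    "eps0 p r (Suc n) = (-1) ^ (E + t * Suc n) * int (fact (r * k)) * int (fact (Suc n)) ^ r"
    by (simp_all only: eps0_def n E_def t_def)
  have "(-1 :: int) ^ (E + t * n) = (-1) ^ t * (-1) ^ (E + t * Suc n)"
    by (simp add: power_add)
  moreover have "int (fact (Suc n)) ^ r = int (Suc n ^ r) * int (fact n) ^ r"
    by (simp only: fact_Suc of_nat_mult of_nat_id power_mult_distrib of_nat_power)
  ultimately have "eps0 p r n * int (Suc n ^ r * fact (r * k))
      = (-1) ^ t * int (fact (r * Suc k)) * eps0 p r (Suc n)"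
    by (simp only: e of_nat_mult mult_ac)
  then show ?thesis by (simp only: n n_def[symmetric] t_def)
qed

text \<open>Modulo \<open>p\<close>, \<open>(p - 1 - k) * r + m\<close> is the negative of
  \<open>r * k + r - m\<close>, since the two add up to \<open>p * r\<close>. The rising product
  becomes, up to sign, a falling product, which is a quotient of factorials.\<close>

lemma prod_ascending_CHAR:
  assumes "CHAR('a::comm_ring_1) = p" "k \<le> p - 1" "p > 0"
  shows "(\<Prod>m<r. of_nat ((p - 1 - k) * r + m) :: 'a) * of_nat (fact (r * k))
    = (-1) ^ r * of_nat (fact (r * Suc k))"
proof -
  have "of_nat ((p - 1 - k) * r + m) = (- of_nat (r * k + r - m) :: 'a)" if "m < r" for m
  proof -
    have "(p - 1 - k) * r + m + (r * k + r - m) = (p - 1 - k + k + 1) * r"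
      using that by (simp add: algebra_simps)
    also have "\<dots> = p * r" using assms(2,3) by simp
    finally have "of_nat ((p - 1 - k) * r + m + (r * k + r - m)) = (of_nat (p * r) :: 'a)"
      by (rule arg_cong)
    then have "of_nat ((p - 1 - k) * r + m) + of_nat (r * k + r - m) = (0 :: 'a)"
      using of_nat_CHAR[where 'a = 'a] assms(1) by (simp only: of_nat_add of_nat_mult) simp
    then show ?thesis by (simp only: eq_neg_iff_add_eq_0)
  qed
  then have "(\<Prod>m<r. of_nat ((p - 1 - k) * r + m) :: 'a) = (\<Prod>m<r. - of_nat (r * k + r - m))"
    by (intro prod.cong) auto
  also have "\<dots> = (-1) ^ r * of_nat (\<Prod>m<r. r * k + r - m)"
    by (simp only: prod_uminus card_lessThan of_nat_prod)
  finally show ?thesis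
    by (simp only: mult.assoc of_nat_mult[symmetric] fact_add_prod) (simp add: add.commute)
qed

section \<open>The determinant for \<open>d = r - 1\<close>\<close>

text \<open>Induction on \<open>k = p - 1 - e\<close>; the recursion determines the determinant only up to the factor
  \<open>delta r x ^ 2\<close>, whence the injectivity hypothesis.\<close>

lemma det_Mmat_fpoly_inj:
  fixes x :: "nat \<Rightarrow> 'a::comm_ring_1"
  assumes pr: "prime p" and ch: "CHAR('a) = p" and inj: "inj ((*) (delta r x))"
    and "2 \<le> r" and "r * k \<le> p - 1"
  shows "det (Mmat p (r - 1) (fpoly r x ^ (p - 1 - k)))
    = of_int (eps0 p r (p - 1 - k)) * delta r x ^ (p - 1 - 2 * k)"
  using assms(5)
proof (induction k)
  case 0
  have p: "p > 0" using pr by (rule prime_gt_0_nat)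
  have "det (Mmat p (r - 1) (fpoly r x ^ (p - 1)))
      = (-1) ^ (r + 1) * ((-1) ^ (r + 1) * det (Mmat p (r - 1) (fpoly r x ^ (p - 1))))"
    by (simp add: mult.assoc[symmetric] flip: power_mult_distrib)
  also have "(-1) ^ (r + 1) * det (Mmat p (r - 1) (fpoly r x ^ (p - 1)))
      = det (Mmat p r (fpoly r x ^ (p - 1)))"
    using assms(4) p by (intro det_Mmat_fpoly_top[symmetric]) auto
  also have "\<dots> = (-1) ^ (r * (r - 1) div 2) * delta r x ^ (p - 1)"
    by (rule det_Mmat_fpoly_pred[OF pr ch inj])
  finally show ?case by (simp only: diff_zero mult_0_right eps0_top[OF pr ch] power_add) (simp only: mult_ac)
next
  case (Suc k)
  define s where "s = (-1 :: 'a) ^ (r * (r - 1) div 2)"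
  define \<delta> where "\<delta> = delta r x"
  define n where "n = p - 1 - Suc k"
  \<comment> \<open>The integer factor to be cancelled at the end; it is prime to \<open>p\<close>
    because \<open>p - 1 - k\<close> lies strictly between 0 and \<open>p\<close>, and
    \<open>r * k < p\<close>.\<close>
  define c where "c = (p - 1 - k) ^ r * fact (r * k)"
  define E where "E = of_int (eps0 p r n) * \<delta> ^ (p - 1 - 2 * Suc k)"
  have p: "p > 0" using pr by (rule prime_gt_0_nat)
  \<comment> \<open>\<open>2 \<le> r\<close> keeps \<open>2 * Suc k\<close> at most
    \<open>p - 1\<close>, so the subtraction in the exponent of \<open>\<delta>\<close> is not
    truncated and the exponent drops by exactly 2.\<close>
  have "2 * Suc k \<le> r * Suc k" using assms(4) by (intro mult_right_mono) auto
  then have k2: "2 * Suc k \<le> p - 1" using Suc.prems by linarith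
  have n: "Suc n = p - 1 - k" using k2 by (simp add: n_def)
  have rk: "r * k \<le> p - 1" using Suc.prems by simp
  have ss: "s * s = 1" by (simp add: s_def flip: power_mult_distrib)
  have r: "Suc (r - 1) = r" using assms(4) by simp
  have step: "det (Mmat p (r - 1) (fpoly r x ^ n)) * (of_nat (p - 1 - k) ^ r * (s * \<delta>\<^sup>2))
      = (\<Prod>m<r. of_nat ((p - 1 - k) * r + m)) * det (Mmat p (r - 1) (fpoly r x ^ (p - 1 - k)))"
    using det_Mmat_fpoly_step[OF pr ch, where d = "r - 1" and x = x and n = n] inj
    unfolding r n s_def \<delta>_def by simp
  have "\<not> p dvd p - 1 - k" using k2 by (intro nat_dvd_not_less) auto
  moreover have "\<not> p dvd fact (r * k)" using pr rk p by (simp add: prime_dvd_fact_iff)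
  ultimately have c: "\<not> p dvd c"
    using pr by (auto simp: c_def prime_dvd_mult_iff dest: prime_dvd_power)
  have "of_nat c * (\<delta>\<^sup>2 * det (Mmat p (r - 1) (fpoly r x ^ n)))
      = s * of_nat (fact (r * k)) * (det (Mmat p (r - 1) (fpoly r x ^ n)) * (of_nat (p - 1 - k) ^ r * (s * \<delta>\<^sup>2)))"
    by (simp add: c_def mult_ac) (simp add: mult.assoc[symmetric] ss)
  also have "\<dots> = s * ((\<Prod>m<r. of_nat ((p - 1 - k) * r + m)) * of_nat (fact (r * k)))
      * det (Mmat p (r - 1) (fpoly r x ^ (p - 1 - k)))"
    unfolding step by (simp only: mult_ac)
  also have "\<dots> = s * ((-1) ^ r * of_nat (fact (r * Suc k)))
      * (of_int (eps0 p r (p - 1 - k)) * \<delta> ^ (p - 1 - 2 * k))"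
    using Suc.IH[OF rk] prod_ascending_CHAR[OF ch _ p, of k r] k2 by (simp add: \<delta>_def)
  also have "\<dots> = of_int ((-1) ^ (r * (r + 1) div 2) * int (fact (r * Suc k)) * eps0 p r (p - 1 - k))
      * \<delta> ^ (p - 1 - 2 * k)"
    unfolding triangular_sign_shift s_def of_int_mult of_int_of_nat_eq
    by (simp add: power_add mult_ac del: mult_Suc_right)
  also have "\<dots> = of_int (eps0 p r n * int c) * \<delta> ^ (p - 1 - 2 * k)"
    using eps0_step[of k p r] k2 by (simp add: n_def c_def)
  also have "p - 1 - 2 * k = 2 + (p - 1 - 2 * Suc k)" using k2 by simp
  also have "of_int (eps0 p r n * int c) * \<delta> ^ (2 + (p - 1 - 2 * Suc k)) = of_nat c * (\<delta>\<^sup>2 * E)"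
    unfolding power_add E_def by (simp add: mult_ac)
  finally have "\<delta>\<^sup>2 * det (Mmat p (r - 1) (fpoly r x ^ n)) = \<delta>\<^sup>2 * E"
    by (rule of_nat_cancel_CHAR[OF pr ch c])
  then show ?case
    using inj unfolding inj_def power2_eq_square mult.assoc n_def E_def \<delta>_def by blast
qed

section \<open>Specialisation from cancellable differences\<close>

lemma (in comm_ring_hom) hom_det_Mmat_fpoly:
  "hom (det (Mmat p d (fpoly r x ^ e))) = det (Mmat p d (fpoly r (\<lambda>i. hom (x i)) ^ e))"
proof -
  interpret mp: map_poly_comm_ring_hom hom ..
  have "map_poly hom (fpoly r x ^ e) = fpoly r (\<lambda>i. hom (x i)) ^ e"
    by (simp add: fpoly_def mp.hom_power mp.hom_prod hom_distribs)
  then have "hom (coeff (fpoly r x ^ e) l) = coeff (fpoly r (\<lambda>i. hom (x i)) ^ e) l" for l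
    by (metis coeff_map_poly hom_zero)
  then have "map_mat hom (Mmat p d (fpoly r x ^ e)) = Mmat p d (fpoly r (\<lambda>i. hom (x i)) ^ e)"
    by (intro eq_matI) (auto simp: Mmat_def Let_def)
  then show ?thesis by (metis hom_det)
qed

lemma inj_mult_prod:
  fixes c :: "'b \<Rightarrow> 'a::comm_ring_1"
  assumes "\<And>i. i \<in> S \<Longrightarrow> inj ((*) (c i))"
  shows "inj ((*) (\<Prod>i\<in>S. c i))"
  using assms
proof (induction S rule: infinite_finite_induct)
  case (insert i S)
  have "inj ((*) (c i) \<circ> (*) (\<Prod>i\<in>S. c i))"
    using insert by (intro inj_compose) auto
  moreover have "(*) (c i) \<circ> (*) (\<Prod>i\<in>S. c i) = (*) (c i * (\<Prod>i\<in>S. c i))"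
    by (auto simp: mult.assoc)
  ultimately show ?case by (simp only: prod.insert[OF insert.hyps])
qed (auto intro: injI)

text \<open>The top coefficient of \<open>c\<close> is the unit -1, so for nonzero \<open>w\<close>
  the product \<open>c * w\<close> has the nonzero coefficient \<open>- lead_coeff w\<close> at
  exponent \<open>n + degree w\<close>, whatever zero divisors there are.\<close>

lemma inj_mult_uminus_monic:
  fixes c :: "'a::comm_ring_1 poly"
  assumes "coeff c n = -1" "\<And>i. n < i \<Longrightarrow> coeff c i = 0"
  shows "inj ((*) c)"
proof (rule injI)
  fix u v assume "c * u = c * v"
  then have *: "c * (u - v) = 0" by (simp add: algebra_simps)
  show "u = v"
  proof (rule ccontr)
    assume "u \<noteq> v"
    then have "lead_coeff (u - v) \<noteq> 0" by (simp only: leading_coeff_0_iff) simp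
    moreover from this have "(1 :: 'a) \<noteq> 0" by (metis mult_1 mult_zero_left)
    then have "degree c = n" using assms
      by (metis degree_le le_antisym le_degree neg_equal_0_iff_equal)
    then have "coeff (c * (u - v)) (n + degree (u - v)) = - lead_coeff (u - v)"
      using coeff_mult_degree_sum[of c "u - v"] assms(1) by simp
    ultimately show False using * by simp
  qed
qed

text \<open>The perturbed roots \<open>x i + t ^ i\<close> have differences that are monic up to sign, hence a
  cancellable \<open>delta\<close> over any commutative ring, and specialise to \<open>x\<close> at \<open>t = 0\<close>.\<close>

lemma det_Mmat_fpoly:
  fixes x :: "nat \<Rightarrow> 'a::comm_ring_1"
  assumes "prime p" "CHAR('a) = p" "2 \<le> r" "r * k \<le> p - 1"
  shows "det (Mmat p (r - 1) (fpoly r x ^ (p - 1 - k)))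
    = of_int (eps0 p r (p - 1 - k)) * delta r x ^ (p - 1 - 2 * k)"
proof -
  define y where "y i = [:x i:] + monom 1 i" for i
  have ev: "comm_ring_hom (\<lambda>q::'a poly. poly q 0)"
    by unfold_locales auto
  have yx: "poly (y i) 0 = x i" if "i \<in> {1..r}" for i
    using that by (simp add: y_def poly_monom power_0_left)
  have "inj ((*) (y i - y j))" if "1 \<le> i" "i < j" for i j
  proof (rule inj_mult_uminus_monic)
    show "coeff (y i - y j) j = -1"
      using that by (simp add: y_def coeff_pCons split: nat.splits)
    show "coeff (y i - y j) l = 0" if "j < l" for l
      using that \<open>i < j\<close> by (simp add: y_def coeff_pCons split: nat.splits)
  qed
  then have "inj ((*) (delta r y))"
    unfolding delta_def by (intro inj_mult_prod) auto
  then have "det (Mmat p (r - 1) (fpoly r y ^ (p - 1 - k)))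
      = of_int (eps0 p r (p - 1 - k)) * delta r y ^ (p - 1 - 2 * k)"
    using assms by (intro det_Mmat_fpoly_inj) auto
  then have "det (Mmat p (r - 1) (fpoly r (\<lambda>i. poly (y i) 0) ^ (p - 1 - k)))
      = of_int (eps0 p r (p - 1 - k)) * poly (delta r y) 0 ^ (p - 1 - 2 * k)"
    by (simp add: comm_ring_hom.hom_det_Mmat_fpoly[OF ev, symmetric])
  moreover have "fpoly r (\<lambda>i. poly (y i) 0) = fpoly r x" "poly (delta r y) 0 = delta r x"
    by (auto simp: fpoly_def delta_def poly_prod yx intro!: prod.cong)
  ultimately show ?thesis by simp
qed

section \<open>The three families of triples\<close>

lemma det_Mmat_B_zero:
  fixes x :: "nat \<Rightarrow> 'a::comm_ring_1"
  assumes "prime p" "CHAR('a) = p" "(r, e, d) \<in> B_zero p"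
  shows "det (Mmat p d (fpoly r x ^ e)) = of_int (eps0 p r e) * delta r x ^ (2 * e - (p - 1))"
proof -
  have b: "2 \<le> r" "e \<le> p - 1" "r * (p - 1 - e) \<le> p - 1" "d = r - 1"
    using assms(3) by (auto simp: B_zero_def)
  have "p - 1 - (p - 1 - e) = e" "p - 1 - 2 * (p - 1 - e) = 2 * e - (p - 1)"
    using b(2) by linarith+
  then show ?thesis using det_Mmat_fpoly[OF assms(1,2) b(1,3), of x] b(4) by simp
qed

lemma B_plus_imp_B_zero:
  assumes "prime p" "(r, e, d) \<in> B_plus p"
  shows "(r, e, d - 1) \<in> B_zero p"
  using assms prime_ge_2_nat[OF assms(1)] by (auto simp: B_plus_def B_zero_def)

text \<open>For \<open>r = 2\<close> the equation would give \<open>2 * e = p - 1\<close>, against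
  \<open>p - 1 < 2 * e\<close>; and \<open>r\<close> divides \<open>p - 1 > 0\<close>. The lower
  bound makes \<open>d = r - 2\<close> positive.\<close>

lemma B_minus_bounds:
  assumes "prime p" "(r, e, d) \<in> B_minus p"
  shows "3 \<le> r" "r \<le> p - 1"
proof -
  have b: "2 \<le> r" "p - 1 < 2 * e" "e \<le> p - 1" "r * (p - 1 - e) = p - 1"
    using assms(2) by (auto simp: B_minus_def)
  have "r \<noteq> 2" using b by auto
  then show "3 \<le> r" using b(1) by simp
  have "p - 1 > 0" using prime_gt_1_nat[OF assms(1)] by simp
  then show "r \<le> p - 1" using b(4) by (metis dvd_imp_le dvd_triv_left)
qed

lemma B_minus_imp_B_zero:
  assumes "prime p" "(r, e, d) \<in> B_minus p"
  shows "(r, e, d + 1) \<in> B_zero p"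
  using assms(2) B_minus_bounds[OF assms] by (auto simp: B_minus_def B_zero_def)

text \<open>For \<open>r \<ge> 2\<close> the values \<open>r\<close>, \<open>r - 1\<close>,
  \<open>r - 2\<close> of \<open>d\<close> are distinct, so the three cases are disjoint.\<close>

lemma epsB_simps:
  "(r, e, d) \<in> B_plus p \<Longrightarrow> epsB p r e d = (-1) ^ (r - 1) * eps0 p r e"
  "(r, e, d) \<in> B_zero p \<Longrightarrow> epsB p r e d = eps0 p r e"
  "(r, e, d) \<in> B_minus p \<Longrightarrow> epsB p r e d = (-1) ^ r * eps0 p r e"
  by (auto simp: epsB_def B_plus_def B_zero_def B_minus_def)

lemma not_dvd_eps0:
  assumes "prime p" "e \<le> p - 1" "r * (p - 1 - e) \<le> p - 1"
  shows "\<not> int p dvd eps0 p r e"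
proof -
  have p: "p > 0" using assms(1) by (rule prime_gt_0_nat)
  have f: "\<not> p dvd fact m" if "m \<le> p - 1" for m
    using assms(1) p that by (simp add: prime_dvd_fact_iff)
  have "\<not> p dvd fact (r * (p - 1 - e)) * fact e ^ r"
    using assms(1) f[OF assms(2)] f[OF assms(3)] by (auto simp: prime_dvd_mult_iff dest: prime_dvd_power)
  then have "\<not> int p dvd int (fact (r * (p - 1 - e)) * fact e ^ r)"
    by (simp only: int_dvd_int_iff) simp
  moreover have "eps0 p r e = (-1) ^ ((r+1)*(r+2) div 2 + (r*(r+1) div 2) * e)
      * int (fact (r * (p - 1 - e)) * fact e ^ r)"
    by (simp add: eps0_def)
  moreover have "(-1 :: int) ^ n = 1 \<or> (-1 :: int) ^ n = -1" for n :: nat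
    by (cases "even n") auto
  ultimately show ?thesis
    by (metis dvd_minus_iff mult_1 mult_minus1)
qed

lemma det_Mmat_B_set:
  fixes x :: "nat \<Rightarrow> 'a::comm_ring_1"
  assumes pr: "prime p" and ch: "CHAR('a) = p" and B: "(r, e, d) \<in> B_set p"
  shows "det (Mmat p d (fpoly r x ^ e)) = of_int (epsB p r e d) * delta r x ^ (2 * e - (p - 1))"
proof -
  have p: "p > 0" using pr by (rule prime_gt_0_nat)
  from B consider "(r, e, d) \<in> B_plus p" | "(r, e, d) \<in> B_zero p" | "(r, e, d) \<in> B_minus p"
    by (auto simp: B_set_def)
  then show ?thesis
  proof cases
    case 1
    then have "d = r" "e = p - 1" "2 \<le> r" by (auto simp: B_plus_def)
    then have "det (Mmat p d (fpoly r x ^ e)) = (-1) ^ (r + 1) * det (Mmat p (d - 1) (fpoly r x ^ e))"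
      using det_Mmat_fpoly_top[OF p, of d r e x] by simp
    also have "(-1) ^ (r + 1) = (-1 :: 'a) ^ (r - 1)"
      using \<open>2 \<le> r\<close> by (cases r) auto
    finally show ?thesis
      using det_Mmat_B_zero[OF pr ch B_plus_imp_B_zero[OF pr 1], of x] 1
      by (simp add: epsB_simps(1) mult.assoc)
  next
    case 2
    then show ?thesis using det_Mmat_B_zero[OF pr ch 2] by (simp add: epsB_simps)
  next
    case 3
    then have b: "d = r - 2" "e \<le> p - 1" "r * (p - 1 - e) = p - 1" by (auto simp: B_minus_def)
    have r: "3 \<le> r" by (rule B_minus_bounds[OF pr 3])
    \<comment> \<open>Subtracting \<open>r * (p - 1 - e) = p - 1\<close> from
      \<open>r * (p - 1)\<close> gives \<open>r * e = (r - 1) * (p - 1)\<close>, the condition of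
      \<open>det_Mmat_fpoly_top\<close> for size \<open>d + 1 = r - 1\<close>.\<close>
    have "r * e + r * (p - 1 - e) = r * (e + (p - 1 - e))"
      by (simp only: distrib_left)
    also have "e + (p - 1 - e) = p - 1" using b(2) by linarith
    finally have "r * e + r * (p - 1 - e) = r * (p - 1)" .
    then have "(d + 1) * (p - 1) = r * e" using b(1,3) r
      by (simp add: diff_mult_distrib)
    then have "det (Mmat p (d + 1) (fpoly r x ^ e)) = (-1) ^ (d + 1 + 1) * det (Mmat p d (fpoly r x ^ e))"
      using det_Mmat_fpoly_top[OF p, of "d + 1" r e x] by (simp only: add_diff_cancel_right')
    also have "d + 1 + 1 = r" using b(1) r by simp
    finally have "det (Mmat p (d + 1) (fpoly r x ^ e)) = (-1) ^ r * det (Mmat p d (fpoly r x ^ e))" .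
    then have "(-1) ^ r * det (Mmat p (d + 1) (fpoly r x ^ e))
        = ((-1) ^ r * (-1) ^ r) * det (Mmat p d (fpoly r x ^ e))"
      by (simp only: mult.assoc)
    also have "\<dots> = det (Mmat p d (fpoly r x ^ e))" by simp
    finally show ?thesis
      using det_Mmat_B_zero[OF pr ch B_minus_imp_B_zero[OF pr 3], of x] 3
      by (simp add: epsB_simps(3) mult.assoc)
  qed
qed

lemma not_dvd_epsB:
  assumes "prime p" "(r, e, d) \<in> B_set p"
  shows "\<not> int p dvd epsB p r e d"
proof -
  have "e \<le> p - 1" "r * (p - 1 - e) \<le> p - 1"
    using assms(2) by (auto simp: B_set_def B_plus_def B_zero_def B_minus_def)
  then have "\<not> int p dvd eps0 p r e" by (rule not_dvd_eps0[OF assms(1)])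
  moreover have "epsB p r e d = eps0 p r e \<or> epsB p r e d = - eps0 p r e"
    unfolding epsB_def by (cases "even r"; cases "even (r - 1)") auto
  ultimately show ?thesis by auto
qed

theorem theorem1:
  fixes p :: nat
  assumes "prime p" and "CHAR('a::comm_ring_1) = p"
  shows "B_set p \<subseteq> A_set TYPE('a) p
    \<and> (\<forall>r e d. (r,e,d) \<in> B_set p \<longrightarrow>
          \<not> int p dvd epsB p r e d
        \<and> (\<forall>x :: nat \<Rightarrow> 'a.
             det (Mmat p d (fpoly r x ^ e)) = of_int (epsB p r e d) * delta r x ^ (2*e - (p-1))))
    \<and> (\<forall>r e d. (r,e,d) \<in> B_plus p \<longrightarrow>
          (r,e,d-1) \<in> B_zero p \<and> epsB p r e d = (-1)^(r-1) * epsB p r e (d-1))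
    \<and> (\<forall>r e d. (r,e,d) \<in> B_zero p \<longrightarrow>
          epsB p r e d = (-1) ^ ((r+1)*(r+2) div 2 + (r*(r+1) div 2) * e)
                 * int (fact (r * (p - 1 - e))) * int (fact e) ^ r)
    \<and> (\<forall>r e d. (r,e,d) \<in> B_minus p \<longrightarrow>
          (r,e,d+1) \<in> B_zero p \<and> epsB p r e d = (-1)^r * epsB p r e (d+1))"
proof (intro conjI allI impI)
  show "B_set p \<subseteq> A_set TYPE('a) p"
  proof
    fix z assume "z \<in> B_set p"
    moreover obtain r e d where z: "z = (r, e, d)" by (cases z)
    ultimately have B: "(r, e, d) \<in> B_set p" by simp
    \<comment> \<open>Positivity of the exponent is \<open>p - 1 < 2 * e\<close>, which for
      \<open>e = p - 1\<close> follows from \<open>p \<ge> 2\<close>; \<open>1 \<le> d\<close> needs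
      \<open>3 \<le> r\<close> in the case of \<open>B_minus\<close>.\<close>
    have bounds: "2 \<le> r" "1 \<le> e" "1 \<le> d" "d \<le> p" "0 < 2 * e - (p - 1)"
      using B B_minus_bounds[OF assms(1), of r e d] prime_ge_2_nat[OF assms(1)]
      by (auto simp: B_set_def B_plus_def B_zero_def B_minus_def)
    have "\<exists>\<epsilon>::int. \<not> int p dvd \<epsilon> \<and> (\<exists>g::nat. 0 < g \<and>
        (\<forall>x :: nat \<Rightarrow> 'a. det (Mmat p d (fpoly r x ^ e)) = of_int \<epsilon> * delta r x ^ g))"
      using not_dvd_epsB[OF assms(1) B] det_Mmat_B_set[OF assms B] bounds(5) by blast
    then show "z \<in> A_set TYPE('a) p"
      using bounds unfolding z A_set_def by simp
  qed
next
  fix r e d assume B: "(r, e, d) \<in> B_set p"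
  show "\<not> int p dvd epsB p r e d" by (rule not_dvd_epsB[OF assms(1) B])
  show "det (Mmat p d (fpoly r x ^ e)) = of_int (epsB p r e d) * delta r x ^ (2*e - (p-1))"
    for x :: "nat \<Rightarrow> 'a" by (rule det_Mmat_B_set[OF assms B])
next
  fix r e d assume B: "(r, e, d) \<in> B_plus p"
  show B0: "(r, e, d - 1) \<in> B_zero p" by (rule B_plus_imp_B_zero[OF assms(1) B])
  show "epsB p r e d = (-1)^(r-1) * epsB p r e (d-1)"
    by (simp only: epsB_simps(1)[OF B] epsB_simps(2)[OF B0])
next
  fix r e d assume "(r, e, d) \<in> B_zero p"
  then show "epsB p r e d = (-1) ^ ((r+1)*(r+2) div 2 + (r*(r+1) div 2) * e)
      * int (fact (r * (p - 1 - e))) * int (fact e) ^ r"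
    by (simp only: epsB_simps(2) eps0_def)
next
  fix r e d assume B: "(r, e, d) \<in> B_minus p"
  show B0: "(r, e, d + 1) \<in> B_zero p" by (rule B_minus_imp_B_zero[OF assms(1) B])
  show "epsB p r e d = (-1)^r * epsB p r e (d+1)"
    by (simp only: epsB_simps(3)[OF B] epsB_simps(2)[OF B0])
qed

end
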